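(* Let $R,S$ be rings and let $W$ be an $(R,S)$-bimodule. The nondegenerate-simple $(R,S)$-bimaps into $W$ are division maps; that is, if an $(R,S)$-bimap $B$ into $W$ is nondegenerate-simple, then $B$ is a division map.
   Context: Homomorphisms of left $R$-modules are written on the right of their arguments ($u\mu$), homomorphisms of right $S$-modules on the left ($\nu v$). For a left $R$-module $U$ and a right $S$-module $V$, an $(R,S)$-bimap $B:U\times V\to W$, written $uBv$, is a function additive in each variable with $(ru)Bv=r(uBv)$ and $uB(vs)=(uBv)s$ for all $r\in R$, $s\in S$, $u\in U$, $v\in V$. Write $\overleftarrow{B}=U$, $\overrightarrow{B}=V$. $B$ is nonzero if it is not the identically zero map. $B$ is a division map (division bimap) if $uBv=0$ implies $u=0$ or $v=0$. The adjoint category $\mathrm{Adj}(W)$ has the $(R,S)$-bimaps into $W$ as objects; a morphism (adjoint-morphism) from $B$ to $C$ is a pair $(\overleftarrow{\mu},\overrightarrow{\mu})\in\mathrm{Hom}_R(\overleftarrow{B},\overleftarrow{C})\times\mathrm{Hom}_S(\overrightarrow{C},\overrightarrow{B})$ with $(u\overleftarrow{\mu})Cv'=uB(\overrightarrow{\mu}v')$ for all $u\in\overleftarrow{B}$, $v'\in\overrightarrow{C}$. The composite of $(\overleftarrow{\mu},\overrightarrow{\mu}):B\to C$ followed by $(\overleftarrow{\nu},\overrightarrow{\nu}):C\to D$ is the pair consisting of $u\mapsto (u\overleftarrow{\mu})\overleftarrow{\nu}$ and $v\mapsto \overrightarrow{\mu}(\overrightarrow{\nu}v)$. Such a morphism is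 zero if both components are zero, and "monomorphism" is meant in $\mathrm{Adj}(W)$. For a bimap $B:U\times V\to W$ and $X\subseteq U$, $Y\subseteq V$: $X^{\bot}=\{v\in V: xBv=0\ \forall x\in X\}$ and $Y^{\top}=\{u\in U: uBy=0\ \forall y\in Y\}$. $B$ is nondegenerate if $U^{\bot}=0$ and $V^{\top}=0$. An adjoint-morphism $(\overleftarrow{\mu},\overrightarrow{\mu})$ from $B$ to $C$ is nondegenerate if $B$ and $C$ are nondegenerate, $(\ker\overleftarrow{\mu})^{\bot}=\mathrm{im}\,\overrightarrow{\mu}$ (computed in $B$) and $(\ker\overrightarrow{\mu})^{\top}=\mathrm{im}\,\overleftarrow{\mu}$ (computed in $C$). A bimap $B$ is nondegenerate-simple if $B$ is nondegenerate, nonzero, and every nondegenerate adjoint-morphism from $B$ (to any nondegenerate $(R,S)$-bimap into $W$) is either zero or a monomorphism. *)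

theory Defs
  imports "HOL-Algebra.Module" "HOL-Algebra.AbelCoset"
begin

text \<open>
  The locale \<^locale>\<open>module\<close> of \<^theory>\<open>HOL-Algebra.Module\<close> requires a commutative ring, so
  left and right unital modules over an arbitrary unital ring are introduced here.  Left modules use
  the library record \<^typ>\<open>('r, 'm) module\<close>.  As in the library, the multiplicative fields that
  these records inherit from rings carry no information.
\<close>

locale left_module = R?: ring R + M?: abelian_group M
  for R (structure) and M (structure) +
  assumes lsmult_closed: "\<lbrakk>r \<in> carrier R; x \<in> carrier M\<rbrakk> \<Longrightarrow> r \<odot>\<^bsub>M\<^esub> x \<in> carrier M"
    and lsmult_l_distr: "\<lbrakk>r \<in> carrier R; r' \<in> carrier R; x \<in> carrier M\<rbrakk>
      \<Longrightarrow> (r \<oplus>\<^bsub>R\<^esub> r') \<odot>\<^bsub>M\<^esub> x = r \<odot>\<^bsub>M\<^esub> x \<oplus>\<^bsub>M\<^esub> r' \<odot>\<^bsub>M\<^esub> x"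
    and lsmult_r_distr: "\<lbrakk>r \<in> carrier R; x \<in> carrier M; y \<in> carrier M\<rbrakk>
      \<Longrightarrow> r \<odot>\<^bsub>M\<^esub> (x \<oplus>\<^bsub>M\<^esub> y) = r \<odot>\<^bsub>M\<^esub> x \<oplus>\<^bsub>M\<^esub> r \<odot>\<^bsub>M\<^esub> y"
    and lsmult_assoc: "\<lbrakk>r \<in> carrier R; r' \<in> carrier R; x \<in> carrier M\<rbrakk>
      \<Longrightarrow> (r \<otimes>\<^bsub>R\<^esub> r') \<odot>\<^bsub>M\<^esub> x = r \<odot>\<^bsub>M\<^esub> (r' \<odot>\<^bsub>M\<^esub> x)"
    and lsmult_one: "x \<in> carrier M \<Longrightarrow> \<one>\<^bsub>R\<^esub> \<odot>\<^bsub>M\<^esub> x = x"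

record ('s, 'm) right_module = "'m ring" +
  rsmult :: "'m \<Rightarrow> 's \<Rightarrow> 'm"  (infixl \<open>\<triangleleft>\<index>\<close> 70)

locale right_module = S?: ring S + M?: abelian_group M
  for S (structure) and M (structure) +
  assumes rsmult_closed: "\<lbrakk>x \<in> carrier M; s \<in> carrier S\<rbrakk> \<Longrightarrow> x \<triangleleft>\<^bsub>M\<^esub> s \<in> carrier M"
    and rsmult_r_distr: "\<lbrakk>x \<in> carrier M; s \<in> carrier S; s' \<in> carrier S\<rbrakk>
      \<Longrightarrow> x \<triangleleft>\<^bsub>M\<^esub> (s \<oplus>\<^bsub>S\<^esub> s') = x \<triangleleft>\<^bsub>M\<^esub> s \<oplus>\<^bsub>M\<^esub> x \<triangleleft>\<^bsub>M\<^esub> s'"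
    and rsmult_l_distr: "\<lbrakk>x \<in> carrier M; y \<in> carrier M; s \<in> carrier S\<rbrakk>
      \<Longrightarrow> (x \<oplus>\<^bsub>M\<^esub> y) \<triangleleft>\<^bsub>M\<^esub> s = x \<triangleleft>\<^bsub>M\<^esub> s \<oplus>\<^bsub>M\<^esub> y \<triangleleft>\<^bsub>M\<^esub> s"
    and rsmult_assoc: "\<lbrakk>x \<in> carrier M; s \<in> carrier S; s' \<in> carrier S\<rbrakk>
      \<Longrightarrow> x \<triangleleft>\<^bsub>M\<^esub> (s \<otimes>\<^bsub>S\<^esub> s') = (x \<triangleleft>\<^bsub>M\<^esub> s) \<triangleleft>\<^bsub>M\<^esub> s'"
    and rsmult_one: "x \<in> carrier M \<Longrightarrow> x \<triangleleft>\<^bsub>M\<^esub> \<one>\<^bsub>S\<^esub> = x"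

record ('r, 's, 'w) bimodule = "('r, 'w) module" +
  bi_rsmult :: "'w \<Rightarrow> 's \<Rightarrow> 'w"

definition right_reduct :: "('r, 's, 'w, 'x) bimodule_scheme \<Rightarrow> ('s, 'w) right_module"
  where "right_reduct W =
    \<lparr>carrier = carrier W, mult = mult W, one = one W, zero = zero W, add = add W,
     rsmult = bi_rsmult W\<rparr>"

locale bimodule = left_module R W + right_module S "right_reduct W"
  for R (structure) and S (structure) and W (structure) +
  assumes bi_assoc: "\<lbrakk>r \<in> carrier R; x \<in> carrier W; s \<in> carrier S\<rbrakk>
    \<Longrightarrow> bi_rsmult W (r \<odot>\<^bsub>W\<^esub> x) s = r \<odot>\<^bsub>W\<^esub> bi_rsmult W x s"

record ('r, 's, 'u, 'v, 'w) bimap =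
  lmod :: "('r, 'u) module"
  rmod :: "('s, 'v) right_module"
  bop :: "'u \<Rightarrow> 'v \<Rightarrow> 'w"

locale bimap = bimodule R S W + U: left_module R "lmod B" + V: right_module S "rmod B"
  for R (structure) and S (structure) and W (structure) and B +
  assumes bop_closed: "\<lbrakk>u \<in> carrier (lmod B); v \<in> carrier (rmod B)\<rbrakk> \<Longrightarrow> bop B u v \<in> carrier W"
    and bop_add_left: "\<lbrakk>u \<in> carrier (lmod B); u' \<in> carrier (lmod B); v \<in> carrier (rmod B)\<rbrakk>
      \<Longrightarrow> bop B (u \<oplus>\<^bsub>lmod B\<^esub> u') v = bop B u v \<oplus>\<^bsub>W\<^esub> bop B u' v"
    and bop_add_right: "\<lbrakk>u \<in> carrier (lmod B); v \<in> carrier (rmod B); v' \<in> carrier (rmod B)\<rbrakk>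
      \<Longrightarrow> bop B u (v \<oplus>\<^bsub>rmod B\<^esub> v') = bop B u v \<oplus>\<^bsub>W\<^esub> bop B u v'"
    and bop_smult_left: "\<lbrakk>r \<in> carrier R; u \<in> carrier (lmod B); v \<in> carrier (rmod B)\<rbrakk>
      \<Longrightarrow> bop B (r \<odot>\<^bsub>lmod B\<^esub> u) v = r \<odot>\<^bsub>W\<^esub> bop B u v"
    and bop_smult_right: "\<lbrakk>u \<in> carrier (lmod B); v \<in> carrier (rmod B); s \<in> carrier S\<rbrakk>
      \<Longrightarrow> bop B u (v \<triangleleft>\<^bsub>rmod B\<^esub> s) = bi_rsmult W (bop B u v) s"

definition nonzero_bimap ::
    "('r, 's, 'w, 'x) bimodule_scheme \<Rightarrow> ('r, 's, 'u, 'v, 'w) bimap \<Rightarrow> bool"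
  where "nonzero_bimap W B \<longleftrightarrow>
    \<not> (\<forall>u \<in> carrier (lmod B). \<forall>v \<in> carrier (rmod B). bop B u v = \<zero>\<^bsub>W\<^esub>)"

definition division_bimap ::
    "('r, 's, 'w, 'x) bimodule_scheme \<Rightarrow> ('r, 's, 'u, 'v, 'w) bimap \<Rightarrow> bool"
  where "division_bimap W B \<longleftrightarrow>
    (\<forall>u \<in> carrier (lmod B). \<forall>v \<in> carrier (rmod B).
      bop B u v = \<zero>\<^bsub>W\<^esub> \<longrightarrow> u = \<zero>\<^bsub>lmod B\<^esub> \<or> v = \<zero>\<^bsub>rmod B\<^esub>)"

text \<open>
  Homomorphisms are extensional outside the carrier, so that HOL equality of functions is equality
  of homomorphisms.
\<close>

definition left_hom ::
    "('r, 'a) ring_scheme \<Rightarrow> ('r, 'm) module \<Rightarrow> ('r, 'n) module \<Rightarrow> ('m \<Rightarrow> 'n) set"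
  where "left_hom R M N =
    {f \<in> carrier M \<rightarrow>\<^sub>E carrier N.
      (\<forall>x \<in> carrier M. \<forall>y \<in> carrier M. f (x \<oplus>\<^bsub>M\<^esub> y) = f x \<oplus>\<^bsub>N\<^esub> f y) \<and>
      (\<forall>r \<in> carrier R. \<forall>x \<in> carrier M. f (r \<odot>\<^bsub>M\<^esub> x) = r \<odot>\<^bsub>N\<^esub> f x)}"

definition right_hom ::
    "('s, 'a) ring_scheme \<Rightarrow> ('s, 'm) right_module \<Rightarrow> ('s, 'n) right_module \<Rightarrow> ('m \<Rightarrow> 'n) set"
  where "right_hom S M N =
    {f \<in> carrier M \<rightarrow>\<^sub>E carrier N.
      (\<forall>x \<in> carrier M. \<forall>y \<in> carrier M. f (x \<oplus>\<^bsub>M\<^esub> y) = f x \<oplus>\<^bsub>N\<^esub> f y) \<and>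
      (\<forall>x \<in> carrier M. \<forall>s \<in> carrier S. f (x \<triangleleft>\<^bsub>M\<^esub> s) = f x \<triangleleft>\<^bsub>N\<^esub> s)}"

text \<open>
  The adjoint category of \<open>W\<close>: a morphism from \<open>B\<close> to \<open>C\<close> is covariant in the left and contravariant
  in the right component.
\<close>

definition adj_hom ::
    "('r, 'a) ring_scheme \<Rightarrow> ('s, 'b) ring_scheme \<Rightarrow>
      ('r, 's, 'u, 'v, 'w) bimap \<Rightarrow> ('r, 's, 'u', 'v', 'w) bimap \<Rightarrow>
      (('u \<Rightarrow> 'u') \<times> ('v' \<Rightarrow> 'v)) set"
  where "adj_hom R S B C =
    {\<mu> \<in> left_hom R (lmod B) (lmod C) \<times> right_hom S (rmod C) (rmod B).
      \<forall>u \<in> carrier (lmod B). \<forall>v' \<in> carrier (rmod C). bop C (fst \<mu> u) v' = bop B u (snd \<mu> v')}"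

text \<open>The composite of \<open>\<mu> \<in> adj_hom R S B C\<close> followed by \<open>\<nu> \<in> adj_hom R S C D\<close>.\<close>

definition adj_comp ::
    "('r, 's, 'u, 'v, 'w) bimap \<Rightarrow> ('r, 's, 'u'', 'v'', 'w) bimap \<Rightarrow>
      ('u \<Rightarrow> 'u') \<times> ('v' \<Rightarrow> 'v) \<Rightarrow> ('u' \<Rightarrow> 'u'') \<times> ('v'' \<Rightarrow> 'v') \<Rightarrow>
      ('u \<Rightarrow> 'u'') \<times> ('v'' \<Rightarrow> 'v)"
  where "adj_comp B D \<mu> \<nu> =
    (compose (carrier (lmod B)) (fst \<nu>) (fst \<mu>), compose (carrier (rmod D)) (snd \<mu>) (snd \<nu>))"

definition adj_zero ::
    "('r, 's, 'u, 'v, 'w) bimap \<Rightarrow> ('r, 's, 'u', 'v', 'w) bimap \<Rightarrow>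
      ('u \<Rightarrow> 'u') \<times> ('v' \<Rightarrow> 'v) \<Rightarrow> bool"
  where "adj_zero B C \<mu> \<longleftrightarrow>
    (\<forall>u \<in> carrier (lmod B). fst \<mu> u = \<zero>\<^bsub>lmod C\<^esub>) \<and>
    (\<forall>v' \<in> carrier (rmod C). snd \<mu> v' = \<zero>\<^bsub>rmod B\<^esub>)"

text \<open>
  HOL cannot quantify over types inside a formula, so the objects of the adjoint category, here and
  in the definition of nondegenerate-simplicity below, are the bimaps whose two modules have
  carriers in fixed but arbitrary types \<open>'u\<close> and \<open>'v\<close>; these types play the role of a universe.
  Carriers are arbitrary subsets, and a quotient module is realised on coset representatives,
  so the category contains all submodules and quotients of its modules.
\<close>

definition adj_mono ::
    "('r, 'a) ring_scheme \<Rightarrow> ('s, 'b) ring_scheme \<Rightarrow> ('r, 's, 'w, 'x) bimodule_scheme \<Rightarrow>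
      ('r, 's, 'u, 'v, 'w) bimap \<Rightarrow> ('r, 's, 'u, 'v, 'w) bimap \<Rightarrow>
      ('u \<Rightarrow> 'u) \<times> ('v \<Rightarrow> 'v) \<Rightarrow> bool"
  where "adj_mono R S W B C \<mu> \<longleftrightarrow>
    \<mu> \<in> adj_hom R S B C \<and>
    (\<forall>D :: ('r, 's, 'u, 'v, 'w) bimap. bimap R S W D \<longrightarrow>
      (\<forall>\<alpha> \<in> adj_hom R S D B. \<forall>\<beta> \<in> adj_hom R S D B.
        adj_comp D C \<alpha> \<mu> = adj_comp D C \<beta> \<mu> \<longrightarrow> \<alpha> = \<beta>))"

definition rperp ::
    "('r, 's, 'w, 'x) bimodule_scheme \<Rightarrow> ('r, 's, 'u, 'v, 'w) bimap \<Rightarrow> 'u set \<Rightarrow> 'v set"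
  where "rperp W B X = {v \<in> carrier (rmod B). \<forall>x \<in> X. bop B x v = \<zero>\<^bsub>W\<^esub>}"

definition lperp ::
    "('r, 's, 'w, 'x) bimodule_scheme \<Rightarrow> ('r, 's, 'u, 'v, 'w) bimap \<Rightarrow> 'v set \<Rightarrow> 'u set"
  where "lperp W B Y = {u \<in> carrier (lmod B). \<forall>y \<in> Y. bop B u y = \<zero>\<^bsub>W\<^esub>}"

definition nondegenerate_bimap ::
    "('r, 's, 'w, 'x) bimodule_scheme \<Rightarrow> ('r, 's, 'u, 'v, 'w) bimap \<Rightarrow> bool"
  where "nondegenerate_bimap W B \<longleftrightarrow>
    rperp W B (carrier (lmod B)) = {\<zero>\<^bsub>rmod B\<^esub>} \<and> lperp W B (carrier (rmod B)) = {\<zero>\<^bsub>lmod B\<^esub>}"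

definition nondegenerate_adj ::
    "('r, 'a) ring_scheme \<Rightarrow> ('s, 'b) ring_scheme \<Rightarrow> ('r, 's, 'w, 'x) bimodule_scheme \<Rightarrow>
      ('r, 's, 'u, 'v, 'w) bimap \<Rightarrow> ('r, 's, 'u', 'v', 'w) bimap \<Rightarrow>
      ('u \<Rightarrow> 'u') \<times> ('v' \<Rightarrow> 'v) \<Rightarrow> bool"
  where "nondegenerate_adj R S W B C \<mu> \<longleftrightarrow>
    \<mu> \<in> adj_hom R S B C \<and> nondegenerate_bimap W B \<and> nondegenerate_bimap W C \<and>
    rperp W B (a_kernel (lmod B) (lmod C) (fst \<mu>)) = snd \<mu> ` carrier (rmod C) \<and>
    lperp W C (a_kernel (rmod C) (rmod B) (snd \<mu>)) = fst \<mu> ` carrier (lmod B)"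

definition nondegenerate_simple ::
    "('r, 'a) ring_scheme \<Rightarrow> ('s, 'b) ring_scheme \<Rightarrow> ('r, 's, 'w, 'x) bimodule_scheme \<Rightarrow>
      ('r, 's, 'u, 'v, 'w) bimap \<Rightarrow> bool"
  where "nondegenerate_simple R S W B \<longleftrightarrow>
    nondegenerate_bimap W B \<and> nonzero_bimap W B \<and>
    (\<forall>(C :: ('r, 's, 'u, 'v, 'w) bimap) \<mu>.
      bimap R S W C \<and> nondegenerate_adj R S W B C \<mu> \<longrightarrow> adj_zero B C \<mu> \<or> adj_mono R S W B C \<mu>)"

end

theory Submission
  imports Defs
begin

text \<open>
  Suppose that \<open>uBv = 0\<close> with \<open>u\<close> and \<open>v\<close> both nonzero, and put \<open>Y = {u}\<^sup>\<bottom>\<close> and \<open>K = Y\<^sup>\<top>\<close>.  By the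
  Galois connection between the two perps, \<open>Y = K\<^sup>\<bottom>\<close>; this is what makes the quotient
  \<open>U \<rightarrow> U/K\<close> together with the inclusion \<open>Y \<rightarrow> V\<close> a nondegenerate adjoint-morphism from \<open>B\<close> to
  the bimap \<open>U/K \<times> Y \<rightarrow> W\<close> induced by \<open>B\<close> (lemma \<open>perp_quotient_nondegenerate\<close>).  Since \<open>v\<close> is a
  nonzero element of \<open>Y\<close>, this morphism is not zero, so simplicity makes it a monomorphism.

  The right component of an adjoint-morphism is contravariant, so the right component of a
  monomorphism behaves like an epimorphism of right modules: a homomorphism that vanishes on its
  image is zero (lemma \<open>adj_mono_right_cancel\<close>).  Applied to the projection \<open>V \<rightarrow> V/Y\<close>, which
  kills the image \<open>Y\<close>, this gives \<open>Y = V\<close>.  Then \<open>u\<close> lies in \<open>V\<^sup>\<top> = 0\<close>, a contradiction.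

  Both quotients must be realised inside the types of the original modules, because the bimaps
  against which simplicity and monomorphisms are tested have their carriers in these types.  Each
  of them is the quotient by the kernel of an explicit map, and its elements are chosen
  representatives of the fibres of that map.
\<close>

section \<open>Quotient modules on representatives\<close>

definition fibre_rep :: "'a set \<Rightarrow> ('a \<Rightarrow> 'b) \<Rightarrow> 'a \<Rightarrow> 'a"
  where "fibre_rep X f x = inv_into X f (f x)"

lemma fibre_rep_in [simp]: "x \<in> X \<Longrightarrow> fibre_rep X f x \<in> X"
  unfolding fibre_rep_def by (simp add: inv_into_into)

lemma fibre_rep_val: "x \<in> X \<Longrightarrow> f (fibre_rep X f x) = f x"
  unfolding fibre_rep_def by (simp add: f_inv_into_f)

lemma fibre_rep_eq_iff:
  "x \<in> X \<Longrightarrow> y \<in> X \<Longrightarrow> fibre_rep X f x = fibre_rep X f y \<longleftrightarrow> f x = f y"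
  by (metis fibre_rep_def fibre_rep_val)

lemma fibre_rep_idem [simp]: "x \<in> X \<Longrightarrow> fibre_rep X f (fibre_rep X f x) = fibre_rep X f x"
  by (simp add: fibre_rep_def f_inv_into_f)

text \<open>
  The additive part common to left and right modules.  The map \<open>e\<close> picks a representative in each
  class; compatibility with addition on one side suffices, since addition is commutative, and it
  implies that \<open>e\<close> is idempotent.  The quotient is described by its operations so that it may be
  any record that extends rings.
\<close>

lemma abelian_group_on_representatives:
  fixes M :: "('m, 'y) ring_scheme" and N :: "('m, 'z) ring_scheme"
  assumes "abelian_group M"
    and e: "\<And>x. x \<in> carrier M \<Longrightarrow> e x \<in> carrier M"
    and absorb: "\<And>x y. x \<in> carrier M \<Longrightarrow> y \<in> carrier M \<Longrightarrow> e (e x \<oplus>\<^bsub>M\<^esub> y) = e (x \<oplus>\<^bsub>M\<^esub> y)"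
    and carrier: "carrier N = e ` carrier M"
    and zero: "\<zero>\<^bsub>N\<^esub> = e \<zero>\<^bsub>M\<^esub>"
    and add: "\<And>x y. x \<oplus>\<^bsub>N\<^esub> y = e (x \<oplus>\<^bsub>M\<^esub> y)"
  shows "abelian_group N"
proof -
  interpret abelian_group M by fact
  have idem: "e (e x) = e x" if "x \<in> carrier M" for x
    using absorb[OF that zero_closed] that e by simp
  have absorb': "e (y \<oplus>\<^bsub>M\<^esub> e x) = e (y \<oplus>\<^bsub>M\<^esub> x)" if "x \<in> carrier M" "y \<in> carrier M" for x y
    using absorb[OF that] that e by (simp add: a_comm)
  show ?thesis
  proof (rule abelian_groupI)
    fix x assume "x \<in> carrier N"
    then obtain x' where x: "x = e x'" "x' \<in> carrier M" unfolding carrier by blast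
    have "e (\<ominus>\<^bsub>M\<^esub> x') \<oplus>\<^bsub>N\<^esub> x = \<zero>\<^bsub>N\<^esub>"
      using x e by (simp add: add zero absorb absorb' l_neg)
    then show "\<exists>y\<in>carrier N. y \<oplus>\<^bsub>N\<^esub> x = \<zero>\<^bsub>N\<^esub>"
      using x unfolding carrier by blast
  next
    fix x y assume "x \<in> carrier N" "y \<in> carrier N"
    then show "x \<oplus>\<^bsub>N\<^esub> y = y \<oplus>\<^bsub>N\<^esub> x" by (auto simp: carrier add e a_comm)
  qed (auto simp: carrier zero add e absorb absorb' idem a_assoc)
qed

definition left_quotient :: "('r, 'm) module \<Rightarrow> ('m \<Rightarrow> 'b) \<Rightarrow> ('r, 'm) module"
  where "left_quotient M f = (let e = fibre_rep (carrier M) f in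
    M\<lparr>carrier := e ` carrier M, zero := e \<zero>\<^bsub>M\<^esub>,
      add := \<lambda>x y. e (x \<oplus>\<^bsub>M\<^esub> y), smult := \<lambda>r x. e (r \<odot>\<^bsub>M\<^esub> x)\<rparr>)"

definition right_quotient :: "('s, 'm) right_module \<Rightarrow> ('m \<Rightarrow> 'b) \<Rightarrow> ('s, 'm) right_module"
  where "right_quotient M f = (let e = fibre_rep (carrier M) f in
    M\<lparr>carrier := e ` carrier M, zero := e \<zero>\<^bsub>M\<^esub>,
      add := \<lambda>x y. e (x \<oplus>\<^bsub>M\<^esub> y), rsmult := \<lambda>x s. e (x \<triangleleft>\<^bsub>M\<^esub> s)\<rparr>)"

lemma left_quotient_sel:
  "carrier (left_quotient M f) = fibre_rep (carrier M) f ` carrier M"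
  "\<zero>\<^bsub>left_quotient M f\<^esub> = fibre_rep (carrier M) f \<zero>\<^bsub>M\<^esub>"
  "x \<oplus>\<^bsub>left_quotient M f\<^esub> y = fibre_rep (carrier M) f (x \<oplus>\<^bsub>M\<^esub> y)"
  "r \<odot>\<^bsub>left_quotient M f\<^esub> x = fibre_rep (carrier M) f (r \<odot>\<^bsub>M\<^esub> x)"
  by (simp_all add: left_quotient_def Let_def)

lemma right_quotient_sel:
  "carrier (right_quotient M f) = fibre_rep (carrier M) f ` carrier M"
  "\<zero>\<^bsub>right_quotient M f\<^esub> = fibre_rep (carrier M) f \<zero>\<^bsub>M\<^esub>"
  "x \<oplus>\<^bsub>right_quotient M f\<^esub> y = fibre_rep (carrier M) f (x \<oplus>\<^bsub>M\<^esub> y)"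
  "x \<triangleleft>\<^bsub>right_quotient M f\<^esub> s = fibre_rep (carrier M) f (x \<triangleleft>\<^bsub>M\<^esub> s)"
  by (simp_all add: right_quotient_def Let_def)

text \<open>
  The assumptions say that the fibres of \<open>f\<close> are the classes of a module congruence.  They are
  stated for the fibres so that a map such as \<open>u \<mapsto> uB\<close>, restricted to some right arguments, can
  be used without giving its codomain a module structure.
\<close>

lemma left_quotient_module:
  assumes "left_module R M"
    and add: "\<And>x x' y. \<lbrakk>x \<in> carrier M; x' \<in> carrier M; y \<in> carrier M; f x = f x'\<rbrakk>
      \<Longrightarrow> f (x \<oplus>\<^bsub>M\<^esub> y) = f (x' \<oplus>\<^bsub>M\<^esub> y)"
    and smult: "\<And>r x x'. \<lbrakk>r \<in> carrier R; x \<in> carrier M; x' \<in> carrier M; f x = f x'\<rbrakk>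
      \<Longrightarrow> f (r \<odot>\<^bsub>M\<^esub> x) = f (r \<odot>\<^bsub>M\<^esub> x')"
  shows "left_module R (left_quotient M f)"
    and "restrict (fibre_rep (carrier M) f) (carrier M) \<in> left_hom R M (left_quotient M f)"
proof -
  interpret left_module R M by fact
  let ?e = "fibre_rep (carrier M) f" and ?N = "left_quotient M f"
  have absorb: "?e (?e x \<oplus>\<^bsub>M\<^esub> y) = ?e (x \<oplus>\<^bsub>M\<^esub> y)" if "x \<in> carrier M" "y \<in> carrier M" for x y
    using that by (simp add: fibre_rep_eq_iff fibre_rep_val[of _ _ f] add[of "?e x" x])
  have absorb': "?e (y \<oplus>\<^bsub>M\<^esub> ?e x) = ?e (y \<oplus>\<^bsub>M\<^esub> x)" if "x \<in> carrier M" "y \<in> carrier M" for x y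
    using absorb[OF that] that by (simp add: M.a_comm)
  have absorb_smult: "?e (r \<odot>\<^bsub>M\<^esub> ?e x) = ?e (r \<odot>\<^bsub>M\<^esub> x)"
    if "r \<in> carrier R" "x \<in> carrier M" for r x
    using that by (simp add: fibre_rep_eq_iff fibre_rep_val[of _ _ f] smult[of r "?e x" x] lsmult_closed)
  show "left_module R ?N"
  proof (intro left_module.intro left_module_axioms.intro)
    show "abelian_group ?N"
      by (rule abelian_group_on_representatives[OF M.abelian_group_axioms, where e = ?e])
        (simp_all add: left_quotient_sel absorb)
  next
    fix r r' x assume *: "r \<in> carrier R" "r' \<in> carrier R" "x \<in> carrier ?N"
    then have x: "x \<in> carrier M" by (auto simp: left_quotient_sel)
    show "(r \<oplus>\<^bsub>R\<^esub> r') \<odot>\<^bsub>?N\<^esub> x = r \<odot>\<^bsub>?N\<^esub> x \<oplus>\<^bsub>?N\<^esub> r' \<odot>\<^bsub>?N\<^esub> x"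
      using *(1,2) x by (simp add: left_quotient_sel absorb absorb' lsmult_closed lsmult_l_distr)
    show "(r \<otimes>\<^bsub>R\<^esub> r') \<odot>\<^bsub>?N\<^esub> x = r \<odot>\<^bsub>?N\<^esub> (r' \<odot>\<^bsub>?N\<^esub> x)"
      using *(1,2) x by (simp add: left_quotient_sel absorb_smult lsmult_closed lsmult_assoc)
  qed (auto simp: left_quotient_sel absorb absorb' absorb_smult R.ring_axioms lsmult_closed
      lsmult_r_distr lsmult_one)
  show "restrict ?e (carrier M) \<in> left_hom R M ?N"
    by (auto simp: left_hom_def left_quotient_sel absorb absorb' absorb_smult lsmult_closed)
qed

lemma right_quotient_module:
  assumes "right_module S M"
    and add: "\<And>x x' y. \<lbrakk>x \<in> carrier M; x' \<in> carrier M; y \<in> carrier M; f x = f x'\<rbrakk>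
      \<Longrightarrow> f (x \<oplus>\<^bsub>M\<^esub> y) = f (x' \<oplus>\<^bsub>M\<^esub> y)"
    and smult: "\<And>s x x'. \<lbrakk>s \<in> carrier S; x \<in> carrier M; x' \<in> carrier M; f x = f x'\<rbrakk>
      \<Longrightarrow> f (x \<triangleleft>\<^bsub>M\<^esub> s) = f (x' \<triangleleft>\<^bsub>M\<^esub> s)"
  shows "right_module S (right_quotient M f)"
    and "restrict (fibre_rep (carrier M) f) (carrier M) \<in> right_hom S M (right_quotient M f)"
proof -
  interpret right_module S M by fact
  let ?e = "fibre_rep (carrier M) f" and ?N = "right_quotient M f"
  have absorb: "?e (?e x \<oplus>\<^bsub>M\<^esub> y) = ?e (x \<oplus>\<^bsub>M\<^esub> y)" if "x \<in> carrier M" "y \<in> carrier M" for x y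
    using that by (simp add: fibre_rep_eq_iff fibre_rep_val[of _ _ f] add[of "?e x" x])
  have absorb': "?e (y \<oplus>\<^bsub>M\<^esub> ?e x) = ?e (y \<oplus>\<^bsub>M\<^esub> x)" if "x \<in> carrier M" "y \<in> carrier M" for x y
    using absorb[OF that] that by (simp add: M.a_comm)
  have absorb_smult: "?e (?e x \<triangleleft>\<^bsub>M\<^esub> s) = ?e (x \<triangleleft>\<^bsub>M\<^esub> s)"
    if "s \<in> carrier S" "x \<in> carrier M" for s x
    using that by (simp add: fibre_rep_eq_iff fibre_rep_val[of _ _ f] smult[of s "?e x" x] rsmult_closed)
  show "right_module S ?N"
  proof (intro right_module.intro right_module_axioms.intro)
    show "abelian_group ?N"
      by (rule abelian_group_on_representatives[OF M.abelian_group_axioms, where e = ?e])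
        (simp_all add: right_quotient_sel absorb)
  next
    fix s s' x assume *: "s \<in> carrier S" "s' \<in> carrier S" "x \<in> carrier ?N"
    then have x: "x \<in> carrier M" by (auto simp: right_quotient_sel)
    show "x \<triangleleft>\<^bsub>?N\<^esub> (s \<oplus>\<^bsub>S\<^esub> s') = x \<triangleleft>\<^bsub>?N\<^esub> s \<oplus>\<^bsub>?N\<^esub> x \<triangleleft>\<^bsub>?N\<^esub> s'"
      using *(1,2) x by (simp add: right_quotient_sel absorb absorb' rsmult_closed rsmult_r_distr)
    show "x \<triangleleft>\<^bsub>?N\<^esub> (s \<otimes>\<^bsub>S\<^esub> s') = (x \<triangleleft>\<^bsub>?N\<^esub> s) \<triangleleft>\<^bsub>?N\<^esub> s'"
      using *(1,2) x by (simp add: right_quotient_sel absorb_smult rsmult_closed rsmult_assoc)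
  qed (auto simp: right_quotient_sel absorb absorb' absorb_smult S.ring_axioms rsmult_closed
      rsmult_l_distr rsmult_one)
  show "restrict ?e (carrier M) \<in> right_hom S M ?N"
    by (auto simp: right_hom_def right_quotient_sel absorb absorb' absorb_smult rsmult_closed)
qed

section \<open>Perps\<close>

lemma (in bimap) bop_zero_right:
  assumes "u \<in> carrier (lmod B)"
  shows "bop B u \<zero>\<^bsub>rmod B\<^esub> = \<zero>\<^bsub>W\<^esub>"
proof -
  have "bop B u \<zero>\<^bsub>rmod B\<^esub> \<oplus>\<^bsub>W\<^esub> bop B u \<zero>\<^bsub>rmod B\<^esub> = bop B u \<zero>\<^bsub>rmod B\<^esub>"
    using bop_add_right[of u "\<zero>\<^bsub>rmod B\<^esub>" "\<zero>\<^bsub>rmod B\<^esub>"] assms by simp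
  then show ?thesis using assms bop_closed by (simp add: local.add.r_cancel_one)
qed

lemma (in bimap) bop_zero_left:
  assumes "v \<in> carrier (rmod B)"
  shows "bop B \<zero>\<^bsub>lmod B\<^esub> v = \<zero>\<^bsub>W\<^esub>"
proof -
  have "bop B \<zero>\<^bsub>lmod B\<^esub> v \<oplus>\<^bsub>W\<^esub> bop B \<zero>\<^bsub>lmod B\<^esub> v = bop B \<zero>\<^bsub>lmod B\<^esub> v"
    using bop_add_left[of "\<zero>\<^bsub>lmod B\<^esub>" "\<zero>\<^bsub>lmod B\<^esub>" v] assms by simp
  then show ?thesis using assms bop_closed by (simp add: local.add.r_cancel_one)
qed

lemma (in bimap) smult_zero_left: "r \<in> carrier R \<Longrightarrow> r \<odot>\<^bsub>W\<^esub> \<zero>\<^bsub>W\<^esub> = \<zero>\<^bsub>W\<^esub>"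
  using bop_smult_left[of r "\<zero>\<^bsub>lmod B\<^esub>" "\<zero>\<^bsub>rmod B\<^esub>"]
  by (simp add: bop_zero_right U.lsmult_closed)

lemma (in bimap) smult_zero_right: "s \<in> carrier S \<Longrightarrow> bi_rsmult W \<zero>\<^bsub>W\<^esub> s = \<zero>\<^bsub>W\<^esub>"
  using bop_smult_right[of "\<zero>\<^bsub>lmod B\<^esub>" "\<zero>\<^bsub>rmod B\<^esub>" s]
  by (simp add: bop_zero_left V.rsmult_closed)

lemma rperp_right_module:
  assumes "bimap R S W B" and X: "X \<subseteq> carrier (lmod B)"
  shows "right_module S (rmod B\<lparr>carrier := rperp W B X\<rparr>)"
proof -
  interpret bimap R S W B by fact
  show ?thesis
  proof (intro right_module.intro right_module_axioms.intro)
    show "abelian_group (rmod B\<lparr>carrier := rperp W B X\<rparr>)"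
    proof (rule abelian_groupI)
      fix v assume v: "v \<in> carrier (rmod B\<lparr>carrier := rperp W B X\<rparr>)"
      then have vV: "v \<in> carrier (rmod B)" by (simp add: rperp_def)
      have "bop B x (\<ominus>\<^bsub>rmod B\<^esub> v) = \<zero>\<^bsub>W\<^esub>" if "x \<in> X" for x
        using bop_add_right[of x v "\<ominus>\<^bsub>rmod B\<^esub> v"] v vV that X bop_closed[of x "\<ominus>\<^bsub>rmod B\<^esub> v"]
        by (auto simp: rperp_def V.M.r_neg bop_zero_right)
      then show "\<exists>y\<in>carrier (rmod B\<lparr>carrier := rperp W B X\<rparr>).
          y \<oplus>\<^bsub>rmod B\<lparr>carrier := rperp W B X\<rparr>\<^esub> v = \<zero>\<^bsub>rmod B\<lparr>carrier := rperp W B X\<rparr>\<^esub>"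
        using vV by (intro bexI[of _ "\<ominus>\<^bsub>rmod B\<^esub> v"]) (auto simp: rperp_def V.M.l_neg)
    qed (use X in \<open>auto simp: rperp_def bop_add_right bop_zero_right subsetD V.M.a_ac\<close>)
  qed (use X in \<open>auto simp: rperp_def S.ring_axioms V.rsmult_closed bop_smult_right subsetD
      smult_zero_right V.rsmult_l_distr V.rsmult_r_distr V.rsmult_assoc V.rsmult_one\<close>)
qed

lemma rperp_lperp_rperp:
  assumes "X \<subseteq> carrier (lmod B)"
  shows "rperp W B (lperp W B (rperp W B X)) = rperp W B X"
  using assms by (auto simp: rperp_def lperp_def)

section \<open>The morphism attached to a perp\<close>

text \<open>
  Restricting \<open>B\<close> to \<open>Y\<close> on the right makes the left elements of \<open>Y\<^sup>\<top>\<close> degenerate; \<open>uB\<close> restricted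
  to \<open>Y\<close> determines \<open>u\<close> modulo \<open>Y\<^sup>\<top>\<close>, so passing to the fibres of this map is passing to \<open>U/Y\<^sup>\<top>\<close>.
  The operation needs no change, since it is evaluated on representatives.
\<close>

definition perp_quotient ::
    "('r, 's, 'u, 'v, 'w) bimap \<Rightarrow> 'v set \<Rightarrow> ('r, 's, 'u, 'v, 'w) bimap"
  where "perp_quotient B Y =
    \<lparr>lmod = left_quotient (lmod B) (\<lambda>u. restrict (bop B u) Y),
     rmod = rmod B\<lparr>carrier := Y\<rparr>, bop = bop B\<rparr>"

definition perp_quotient_adj :: "('r, 's, 'u, 'v, 'w) bimap \<Rightarrow> 'v set \<Rightarrow> ('u \<Rightarrow> 'u) \<times> ('v \<Rightarrow> 'v)"
  where "perp_quotient_adj B Y =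
    (restrict (fibre_rep (carrier (lmod B)) (\<lambda>u. restrict (bop B u) Y)) (carrier (lmod B)),
     restrict id Y)"

text \<open>
  Being a perp makes \<open>Y\<close> a submodule with \<open>Y = (Y\<^sup>\<top>)\<^sup>\<bottom>\<close>, and \<open>Y\<^sup>\<top>\<close> is the kernel of the left
  component: this is the first of the two image conditions.  The second one holds because the right
  component is injective and the left one surjective.
\<close>

lemma perp_quotient_nondegenerate:
  assumes "bimap R S W B" and ndg: "nondegenerate_bimap W B"
    and X: "X \<subseteq> carrier (lmod B)" and Y: "Y = rperp W B X"
  shows "bimap R S W (perp_quotient B Y)"
    and "nondegenerate_adj R S W B (perp_quotient B Y) (perp_quotient_adj B Y)"
proof -
  interpret bimap R S W B by fact
  let ?f = "\<lambda>u. restrict (bop B u) Y"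
  let ?e = "fibre_rep (carrier (lmod B)) ?f"
  let ?C = "perp_quotient B Y"
  let ?\<mu> = "perp_quotient_adj B Y"
  have YV: "y \<in> carrier (rmod B)" if "y \<in> Y" for y
    using that unfolding Y rperp_def by blast
  have zeroY: "\<zero>\<^bsub>rmod B\<^esub> \<in> Y" using X by (auto simp: Y rperp_def bop_zero_right)
  have f_eq: "?f u = ?f u' \<longleftrightarrow> (\<forall>y\<in>Y. bop B u y = bop B u' y)" for u u'
    by (auto simp: restrict_def fun_eq_iff)
  have bop_e: "bop B (?e u) y = bop B u y" if "u \<in> carrier (lmod B)" "y \<in> Y" for u y
    using fibre_rep_val[of u "carrier (lmod B)" ?f] that unfolding f_eq by blast
  have f_add: "?f (u \<oplus>\<^bsub>lmod B\<^esub> w) = ?f (u' \<oplus>\<^bsub>lmod B\<^esub> w)"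
    if "u \<in> carrier (lmod B)" "u' \<in> carrier (lmod B)" "w \<in> carrier (lmod B)" "?f u = ?f u'" for u u' w
    using that unfolding f_eq by (simp add: bop_add_left YV)
  have f_smult: "?f (r \<odot>\<^bsub>lmod B\<^esub> u) = ?f (r \<odot>\<^bsub>lmod B\<^esub> u')"
    if "r \<in> carrier R" "u \<in> carrier (lmod B)" "u' \<in> carrier (lmod B)" "?f u = ?f u'" for r u u'
    using that unfolding f_eq by (simp add: bop_smult_left YV)
  have quot: "left_module R (left_quotient (lmod B) ?f)"
    "restrict ?e (carrier (lmod B)) \<in> left_hom R (lmod B) (left_quotient (lmod B) ?f)"
    by (rule left_quotient_module[OF U.left_module_axioms]; rule f_add f_smult; assumption)+
  show "bimap R S W ?C"
  proof (intro bimap.intro bimap_axioms.intro)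
    show "bimodule R S W" by (rule bimodule_axioms)
    show "left_module R (lmod ?C)" unfolding perp_quotient_def using quot(1) by simp
    show "right_module S (rmod ?C)"
      unfolding perp_quotient_def Y using rperp_right_module[OF assms(1) X] by simp
  qed (auto simp: perp_quotient_def left_quotient_sel YV bop_e bop_closed bop_add_left
      bop_add_right bop_smult_left bop_smult_right U.lsmult_closed)
  have e_zero: "?e u = ?e \<zero>\<^bsub>lmod B\<^esub> \<longleftrightarrow> u \<in> lperp W B Y" if "u \<in> carrier (lmod B)" for u
    using that by (auto simp: fibre_rep_eq_iff f_eq lperp_def bop_zero_left YV)
  have "right_module S (rmod B\<lparr>carrier := Y\<rparr>)"
    unfolding Y by (rule rperp_right_module[OF assms(1) X])
  then interpret Y: right_module S "rmod B\<lparr>carrier := Y\<rparr>" .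
  have "restrict id Y \<in> right_hom S (rmod B\<lparr>carrier := Y\<rparr>) (rmod B)"
    using Y.a_closed Y.rsmult_closed by (auto simp: right_hom_def YV)
  then have adj: "?\<mu> \<in> adj_hom R S B ?C"
    using quot(2) by (auto simp: adj_hom_def perp_quotient_def perp_quotient_adj_def bop_e)
  have ndgC: "nondegenerate_bimap W ?C"
    unfolding nondegenerate_bimap_def
  proof
    have "rperp W ?C (carrier (lmod ?C)) = Y \<inter> rperp W B (carrier (lmod B))"
      by (auto simp: rperp_def perp_quotient_def left_quotient_sel bop_e YV)
    then show "rperp W ?C (carrier (lmod ?C)) = {\<zero>\<^bsub>rmod ?C\<^esub>}"
      using ndg zeroY by (auto simp: nondegenerate_bimap_def perp_quotient_def)
    have "lperp W ?C (carrier (rmod ?C)) = ?e ` lperp W B Y"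
      by (auto simp: lperp_def perp_quotient_def left_quotient_sel bop_e)
    also have "\<dots> = {?e \<zero>\<^bsub>lmod B\<^esub>}"
    proof -
      have "\<zero>\<^bsub>lmod B\<^esub> \<in> lperp W B Y" using e_zero by blast
      moreover have "lperp W B Y \<subseteq> carrier (lmod B)" by (auto simp: lperp_def)
      ultimately show ?thesis using e_zero by blast
    qed
    finally show "lperp W ?C (carrier (rmod ?C)) = {\<zero>\<^bsub>lmod ?C\<^esub>}"
      by (simp add: perp_quotient_def left_quotient_sel)
  qed
  have "a_kernel (lmod B) (lmod ?C) (fst ?\<mu>) = lperp W B Y"
    using e_zero
    by (auto simp: a_kernel_def' perp_quotient_def perp_quotient_adj_def left_quotient_sel lperp_def)
  then have im_right: "rperp W B (a_kernel (lmod B) (lmod ?C) (fst ?\<mu>)) = snd ?\<mu> ` carrier (rmod ?C)"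
    using rperp_lperp_rperp[OF X, of W]
    by (simp add: Y perp_quotient_def perp_quotient_adj_def)
  have "a_kernel (rmod ?C) (rmod B) (snd ?\<mu>) = {\<zero>\<^bsub>rmod B\<^esub>}"
    using zeroY by (auto simp: a_kernel_def' perp_quotient_def perp_quotient_adj_def)
  then have im_left: "lperp W ?C (a_kernel (rmod ?C) (rmod B) (snd ?\<mu>)) = fst ?\<mu> ` carrier (lmod B)"
    by (auto simp: lperp_def perp_quotient_def perp_quotient_adj_def left_quotient_sel bop_zero_right)
  show "nondegenerate_adj R S W B ?C ?\<mu>"
    unfolding nondegenerate_adj_def using adj ndg ndgC im_right im_left by blast
qed

section \<open>Monomorphisms and division\<close>

text \<open>
  The pair \<open>(0, g)\<close> is a morphism to \<open>B\<close> from the identically zero bimap on \<open>U \<times> N\<close>.  Its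
  composite with \<open>\<mu>\<close> is zero as soon as \<open>g\<close> kills the image of the right component of \<open>\<mu>\<close>, and then
  it agrees with the composite of the zero morphism with \<open>\<mu>\<close>.
\<close>

lemma adj_mono_right_cancel:
  fixes B :: "('r, 's, 'u, 'v, 'w) bimap" and N :: "('s, 'v) right_module"
  assumes B: "bimap R S W B" and mono: "adj_mono R S W B C \<mu>"
    and N: "right_module S N" and g: "g \<in> right_hom S (rmod B) N"
    and g0: "\<And>v'. v' \<in> carrier (rmod C) \<Longrightarrow> g (snd \<mu> v') = \<zero>\<^bsub>N\<^esub>"
    and v: "v \<in> carrier (rmod B)"
  shows "g v = \<zero>\<^bsub>N\<^esub>"
proof -
  interpret bimap R S W B by fact
  interpret N: right_module S N by fact
  define D where "D = \<lparr>lmod = lmod B, rmod = N, bop = \<lambda>_ _. \<zero>\<^bsub>W\<^esub>\<rparr>"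
  define zU where "zU = restrict (\<lambda>_. \<zero>\<^bsub>lmod B\<^esub>) (carrier (lmod B))"
  define zN where "zN = restrict (\<lambda>_. \<zero>\<^bsub>N\<^esub>) (carrier (rmod B))"
  have D: "bimap R S W D"
    by (intro bimap.intro bimap_axioms.intro)
      (simp_all add: D_def bimodule_axioms U.left_module_axioms N smult_zero_left smult_zero_right)
  have lzero: "r \<odot>\<^bsub>lmod B\<^esub> \<zero>\<^bsub>lmod B\<^esub> = \<zero>\<^bsub>lmod B\<^esub>" if "r \<in> carrier R" for r
    using U.lsmult_r_distr[OF that, of "\<zero>\<^bsub>lmod B\<^esub>" "\<zero>\<^bsub>lmod B\<^esub>"] U.lsmult_closed[OF that]
    by simp
  have rzero: "\<zero>\<^bsub>N\<^esub> \<triangleleft>\<^bsub>N\<^esub> s = \<zero>\<^bsub>N\<^esub>" if "s \<in> carrier S" for s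
    using N.rsmult_l_distr[OF _ _ that, of "\<zero>\<^bsub>N\<^esub>" "\<zero>\<^bsub>N\<^esub>"] N.rsmult_closed[OF _ that]
    by simp
  have zU: "zU \<in> left_hom R (lmod B) (lmod B)"
    by (auto simp: zU_def left_hom_def lzero U.lsmult_closed)
  have zN: "zN \<in> right_hom S (rmod B) N"
    by (auto simp: zN_def right_hom_def rzero V.rsmult_closed)
  have "(zU, g) \<in> adj_hom R S D B"
    using zU g by (auto simp: adj_hom_def D_def) (simp add: zU_def bop_zero_left)
  moreover have "(zU, zN) \<in> adj_hom R S D B"
    using zU zN by (auto simp: adj_hom_def D_def) (simp add: zU_def bop_zero_left)
  moreover have "adj_comp D C (zU, g) \<mu> = adj_comp D C (zU, zN) \<mu>"
  proof -
    have "snd \<mu> v' \<in> carrier (rmod B)" if "v' \<in> carrier (rmod C)" for v'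
      using mono that by (auto simp: adj_mono_def adj_hom_def right_hom_def)
    then show ?thesis
      by (auto simp: adj_comp_def compose_def fun_eq_iff zN_def g0 restrict_def)
  qed
  ultimately have "(zU, g) = (zU, zN)"
    using mono D unfolding adj_mono_def by blast
  then show ?thesis using v by (simp add: zN_def)
qed

theorem theorem3p13:
  fixes R :: "('r, 'a) ring_scheme"
    and S :: "('s, 'b) ring_scheme"
    and W :: "('r, 's, 'w, 'x) bimodule_scheme"
    and B :: "('r, 's, 'u, 'v, 'w) bimap"
  assumes "ring R" and "ring S" and "bimodule R S W"
    and "bimap R S W B"
    and "nondegenerate_simple R S W B"
  shows "division_bimap W B"
  unfolding division_bimap_def
proof (intro ballI impI, rule ccontr)
  fix u v
  assume u: "u \<in> carrier (lmod B)" and v: "v \<in> carrier (rmod B)" and uv: "bop B u v = \<zero>\<^bsub>W\<^esub>"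
    and nz: "\<not> (u = \<zero>\<^bsub>lmod B\<^esub> \<or> v = \<zero>\<^bsub>rmod B\<^esub>)"
  interpret bimap R S W B by fact
  define Y where "Y = rperp W B {u}"
  let ?C = "perp_quotient B Y" and ?\<mu> = "perp_quotient_adj B Y"
  let ?N = "right_quotient (rmod B) (bop B u)"
  let ?g = "restrict (fibre_rep (carrier (rmod B)) (bop B u)) (carrier (rmod B))"
  have ndg: "nondegenerate_bimap W B"
    using assms(5) by (simp add: nondegenerate_simple_def)
  have "bimap R S W ?C" "nondegenerate_adj R S W B ?C ?\<mu>"
    using perp_quotient_nondegenerate[OF assms(4) ndg _ Y_def] u by auto
  moreover have "\<not> adj_zero B ?C ?\<mu>"
  proof -
    have "v \<in> Y" using v uv by (simp add: Y_def rperp_def)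
    then show ?thesis
      using nz by (auto simp: adj_zero_def perp_quotient_def perp_quotient_adj_def)
  qed
  ultimately have mono: "adj_mono R S W B ?C ?\<mu>"
    using assms(5) unfolding nondegenerate_simple_def by blast
  \<comment> \<open>\<open>Y\<close> is the kernel of \<open>uB\<close>, so the quotient \<open>V/Y\<close> is formed on the fibres of \<open>uB\<close>.\<close>
  have quot: "right_module S ?N" "?g \<in> right_hom S (rmod B) ?N"
    using u by (auto intro!: right_quotient_module V.right_module_axioms
        simp: bop_add_right bop_smult_right)
  have "?g (snd ?\<mu> y) = \<zero>\<^bsub>?N\<^esub>" if "y \<in> carrier (rmod ?C)" for y
    using that u
    by (simp add: perp_quotient_def perp_quotient_adj_def Y_def rperp_def right_quotient_sel
        fibre_rep_eq_iff bop_zero_right)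
  then have "?g w = \<zero>\<^bsub>?N\<^esub>" if "w \<in> carrier (rmod B)" for w
    using adj_mono_right_cancel[OF assms(4) mono quot _ that] by blast
  then have "bop B u w = \<zero>\<^bsub>W\<^esub>" if "w \<in> carrier (rmod B)" for w
    using that u by (simp add: right_quotient_sel fibre_rep_eq_iff bop_zero_right)
  then have "u \<in> lperp W B (carrier (rmod B))" using u by (simp add: lperp_def)
  then show False using ndg nz by (simp add: nondegenerate_bimap_def)
qed

end
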